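(* Let $\Omega\subset\mathbb{R}^d$ be a bounded open set, $U:=L^2(\Omega)$, and $J:U\to\mathbb{R}$ such that the problem $$\text{(P)}\qquad \min_{u\in U} J(u)\quad\text{subject to } u\ge 0$$ has a (not necessarily unique) global solution $\bar u$. Let the sequence of discretizations $\{(U_n,\mathcal{T}_n,J_n)\}_{n\in\mathbb{N}}$ satisfy conditions (A1)--(A5) given in the context, with discrete problems $(\mathrm{P}_n)$ also given there, and assume in addition that $$\int_T \phi_n^i\ge 0\qquad\text{for all } n\in\mathbb{N},\ T\in\mathcal{T}_n,\ i=1,\dots,N_n.$$ Then: 1. Every weak limit $u$ in $U$ (as $n\to\infty$) of feasible points $u_n$ of $(\mathrm{P}_n)$ is feasible for (P), i.e. $u\ge 0$. 2. The weak limit in $U$ as $n\to\infty$ (if it exists) of global solutions $\bar u_n$ of $(\mathrm{P}_n)$ is a global solution of (P).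
   Context: For each $n\in\mathbb{N}$ a discretization consists of the following objects. (A1) A finite-dimensional subspace $U_n\subset U=L^2(\Omega)$ with a fixed basis $\{\phi_n^1,\dots,\phi_n^{N_n}\}$. (A2) A set $\mathcal{T}_n$ of open, pairwise disjoint elements $T$ with $\overline{\Omega}=\overline{\bigcup_{T\in\mathcal{T}_n}T}$ and $\operatorname{diam}(T)\le h_n$ for all $T\in\mathcal{T}_n$, where $h_n\searrow 0$. (A3) A functional $J_n:U_n\to\mathbb{R}$ approximating $J$. The discrete problem is $$(\mathrm{P}_n)\qquad \min J_n(u_n)\quad\text{subject to } u_n=\sum_{i=1}^{N_n}\lambda_i\,\phi_n^i,\ \text{where } \lambda_i\ge 0\ \text{ for all } i=1,\dots,N_n.$$ That is, a point $u_n\in U_n$ is feasible for $(\mathrm{P}_n)$ if all its coordinates $\lambda_i$ in the basis $\{\phi_n^i\}$ are nonnegative. It is assumed that $(\mathrm{P}_n)$ has a global solution $\bar u_n$. Nonnegativity of the basis functions themselves is not required. The following conditions are imposed on the sequence $\{(U_n,\mathcal{T}_n,J_n)\}_{n\in\mathbb{N}}$, where $\bar u$ is the global solution of (P) fixed in the claim. (A4) $J(u)\le\liminf_{n\to\infty}J_n(u_n)$ for every sequence $\{u_n\}_{n\in\mathbb{N}}$ with $u_n\in U_n$ for all $n\in\mathbb{N}$ and $u_n\rightharpoonup u$ weakly in $U$ as $n\to\infty$. (A5) $J(\bar u)\ge\limsup_{n\to\infty}J_n(v_n)$ for some sequence $\{v_n\}_{n\in\mathbb{N}}$ with $v_n\in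 U_n$.
   Formalization: Two conditions are strengthened because the literal claims fail: in (A2) the elements of T_n are also required to cover Ω up to a set of measure zero, and in (A5) the points v_n are required to be feasible for (P_n), not merely in U_n. *)

theory Defs
  imports "HOL-Analysis.Analysis"
begin

text \<open>
  Elements of \<open>L\<^sup>2(\<Omega>)\<close> are represented by square-integrable functions; equality in the space is
  equality almost everywhere on \<open>\<Omega>\<close>. Values outside \<open>\<Omega>\<close> never matter, since all
  integrals and null sets refer to the measure \<^term>\<open>lebesgue_on \<Omega>\<close>.
\<close>

definition L2 :: "'a::euclidean_space set \<Rightarrow> ('a \<Rightarrow> real) set" where
  "L2 \<Omega> = {u \<in> borel_measurable (lebesgue_on \<Omega>). integrable (lebesgue_on \<Omega>) (\<lambda>x. (u x)\<^sup>2)}"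

definition ae_eq :: "'a::euclidean_space set \<Rightarrow> ('a \<Rightarrow> real) \<Rightarrow> ('a \<Rightarrow> real) \<Rightarrow> bool" where
  "ae_eq \<Omega> u v \<longleftrightarrow> (AE x in lebesgue_on \<Omega>. u x = v x)"

text \<open>
  A real functional on a set \<open>S\<close> of elements of \<open>L\<^sup>2(\<Omega>)\<close> must not depend on the
  representative chosen for its argument.
\<close>

definition functional_on ::
    "'a::euclidean_space set \<Rightarrow> ('a \<Rightarrow> real) set \<Rightarrow> (('a \<Rightarrow> real) \<Rightarrow> real) \<Rightarrow> bool" where
  "functional_on \<Omega> S J \<longleftrightarrow> (\<forall>u\<in>S. \<forall>v\<in>S. ae_eq \<Omega> u v \<longrightarrow> J u = J v)"

text \<open>
  Weak convergence in the Hilbert space \<open>L\<^sup>2(\<Omega>)\<close>: convergence of the inner product with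
  every fixed element of the space.
\<close>

definition weakly_converges ::
    "'a::euclidean_space set \<Rightarrow> (nat \<Rightarrow> 'a \<Rightarrow> real) \<Rightarrow> ('a \<Rightarrow> real) \<Rightarrow> bool" where
  "weakly_converges \<Omega> us u \<longleftrightarrow>
     (\<forall>n. us n \<in> L2 \<Omega>) \<and> u \<in> L2 \<Omega> \<and>
     (\<forall>g\<in>L2 \<Omega>. (\<lambda>n. LINT x|lebesgue_on \<Omega>. us n x * g x)
        \<longlonglongrightarrow> (LINT x|lebesgue_on \<Omega>. u x * g x))"

definition feasible :: "'a::euclidean_space set \<Rightarrow> ('a \<Rightarrow> real) \<Rightarrow> bool" where
  "feasible \<Omega> u \<longleftrightarrow> u \<in> L2 \<Omega> \<and> (AE x in lebesgue_on \<Omega>. u x \<ge> 0)"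

text \<open>
  The functions \<open>\<phi> 1, \<dots>, \<phi> N\<close> form a basis of the subspace \<open>V\<close> of \<open>L\<^sup>2(\<Omega>)\<close>. Both the
  span and linear independence are understood up to null sets; in particular \<open>V\<close> contains all
  representatives of its elements, and it is a finite-dimensional subspace by the spanning clause.
\<close>

definition L2_basis ::
    "'a::euclidean_space set \<Rightarrow> ('a \<Rightarrow> real) set \<Rightarrow> nat \<Rightarrow> (nat \<Rightarrow> 'a \<Rightarrow> real) \<Rightarrow> bool" where
  "L2_basis \<Omega> V N \<phi> \<longleftrightarrow>
     (\<forall>i\<in>{1..N}. \<phi> i \<in> L2 \<Omega>) \<and>
     V = {u \<in> L2 \<Omega>. \<exists>c::nat \<Rightarrow> real. ae_eq \<Omega> u (\<lambda>x. \<Sum>i=1..N. c i * \<phi> i x)} \<and>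
     (\<forall>c::nat \<Rightarrow> real. ae_eq \<Omega> (\<lambda>x. \<Sum>i=1..N. c i * \<phi> i x) (\<lambda>x. 0)
        \<longrightarrow> (\<forall>i\<in>{1..N}. c i = 0))"

definition discrete_feasible ::
    "'a::euclidean_space set \<Rightarrow> ('a \<Rightarrow> real) set \<Rightarrow> nat \<Rightarrow> (nat \<Rightarrow> 'a \<Rightarrow> real) \<Rightarrow> ('a \<Rightarrow> real) \<Rightarrow> bool" where
  "discrete_feasible \<Omega> V N \<phi> u \<longleftrightarrow>
     u \<in> V \<and> (\<exists>c::nat \<Rightarrow> real. (\<forall>i\<in>{1..N}. c i \<ge> 0) \<and>
        ae_eq \<Omega> u (\<lambda>x. \<Sum>i=1..N. c i * \<phi> i x))"

text \<open>
  A family \<open>\<T>\<close> of open, pairwise disjoint elements of diameter at most \<open>h\<close> whose union has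
  the same closure as \<open>\<Omega>\<close>. The last clause, that the elements cover \<open>\<Omega>\<close> up to a null set, is
  not implied by the equality of closures: a dense open subset of \<open>\<Omega>\<close> may omit a (nowhere dense)
  set of positive measure, on which the means over the elements carry no information.
  It does hold, for example, whenever \<open>\<T>\<close> is countable and locally finite and the elements have
  boundaries of measure zero.
\<close>

definition partition_into_elements ::
    "'a::euclidean_space set \<Rightarrow> 'a set set \<Rightarrow> real \<Rightarrow> bool" where
  "partition_into_elements \<Omega> \<T> h \<longleftrightarrow>
     (\<forall>T\<in>\<T>. open T) \<and> pairwise disjnt \<T> \<and>
     closure \<Omega> = closure (\<Union>\<T>) \<and>
     (\<forall>T\<in>\<T>. diameter T \<le> h) \<and>
     negligible (\<Omega> - \<Union>\<T>)"

end

theory Submission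
  imports Defs
begin

text \<open>
  Replacing a nonnegative Lipschitz function \<open>g\<close> on each element by one of its values changes the
  pairing \<open>\<integral> u\<^sub>n g\<close> by at most \<open>L h\<^sub>n \<parallel>u\<^sub>n\<parallel>\<close> in the \<open>L\<^sup>1\<close> norm, and leaves a nonnegative number
  because the means of \<open>u\<^sub>n\<close> over the elements are nonnegative. Weakly convergent sequences are bounded
  in \<open>L\<^sup>1\<close>, so \<open>\<integral> u g \<ge> 0\<close> in the limit. Approximating indicators of closed sets by Lipschitz
  functions, and \<open>{u < 0}\<close> by closed sets from inside, gives \<open>u \<ge> 0\<close> almost everywhere. Optimality
  then follows by comparing with the recovery sequence in (A5).
\<close>

section \<open>Uniform boundedness in L1 from bounded pairings\<close>

lemma integrable_mult_bounded:
  fixes f g :: "'a \<Rightarrow> real"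
  assumes "integrable M f" and "g \<in> borel_measurable M" and "bounded (range g)"
  shows "integrable M (\<lambda>x. f x * g x)"
proof -
  obtain B where B: "\<And>x. \<bar>g x\<bar> \<le> B"
    using assms(3) by (auto simp: bounded_iff)
  have "integrable M (\<lambda>x. B * f x)"
    using assms(1) by simp
  then show ?thesis
  proof (rule Bochner_Integration.integrable_bound)
    show "(\<lambda>x. f x * g x) \<in> borel_measurable M"
      using assms by simp
    have "norm (f x * g x) \<le> norm (B * f x)" for x
    proof -
      have "\<bar>g x\<bar> \<le> \<bar>B\<bar>" using B[of x] by linarith
      then show ?thesis by (simp add: abs_mult mult.commute[of "\<bar>f x\<bar>"] mult_right_mono)
    qed
    then show "AE x in M. norm (f x * g x) \<le> norm (B * f x)" by simp
  qed
qed

text \<open>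
  Gliding hump: the candidate \<open>g\<close> is the uniform limit of functions \<open>X k\<close>, each obtained from
  its predecessor by adding or subtracting \<open>3\<^sup>-\<^sup>k sgn (u (m k))\<close>. Since
  \<open>max \<bar>a + b\<bar> \<bar>a - b\<bar> \<ge> \<bar>b\<bar>\<close>, one of the two signs makes the pairing with \<open>u (m k)\<close> at least
  \<open>3\<^sup>-\<^sup>k\<close> times the norm, and all later corrections together use up at most half of it.
\<close>

lemma Bseq_L1_if_Bseq_pairings:
  fixes u :: "nat \<Rightarrow> 'a \<Rightarrow> real"
  assumes int: "\<And>n. integrable M (u n)"
    and pair: "\<And>g. g \<in> borel_measurable M \<Longrightarrow> bounded (range g) \<Longrightarrow> Bseq (\<lambda>n. LINT x|M. u n x * g x)"
  shows "Bseq (\<lambda>n. LINT x|M. \<bar>u n x\<bar>)"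
proof (rule ccontr)
  assume notB: "\<not> Bseq (\<lambda>n. LINT x|M. \<bar>u n x\<bar>)"
  \<comment> \<open>The base 4 is chosen to beat the step size \<open>(1/3) ^ k\<close>: their
    product \<open>(4/3) ^ k\<close> is unbounded, which yields the final contradiction.\<close>
  have "\<exists>m. 4 ^ k \<le> (LINT x|M. \<bar>u m x\<bar>)" for k
  proof (rule ccontr)
    assume "\<nexists>m. 4 ^ k \<le> (LINT x|M. \<bar>u m x\<bar>)"
    then have "norm (LINT x|M. \<bar>u m x\<bar>) \<le> 4 ^ k" for m
      by (simp add: not_le less_imp_le)
    then show False using notB by (metis BseqI')
  qed
  then obtain m where m: "\<And>k. 4 ^ k \<le> (LINT x|M. \<bar>u (m k) x\<bar>)" by metis
  let ?P = "\<lambda>(k::nat) X. X \<in> borel_measurable M \<and> bounded (range (X :: 'a \<Rightarrow> real))"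
  let ?Q = "\<lambda>k X Y. (\<forall>x. \<bar>Y x - X x\<bar> \<le> (1/3) ^ k) \<and>
     (1/3) ^ k * (LINT x|M. \<bar>u (m k) x\<bar>) \<le> \<bar>LINT x|M. u (m k) x * Y x\<bar>"
  have "\<exists>X. \<forall>k. ?P k (X k) \<and> ?Q k (X k) (X (Suc k))"
  proof (rule dependent_nat_choice)
    show "\<exists>X. ?P 0 X"
      by (rule exI[of _ "\<lambda>_. 0"]) auto
    fix X k assume P: "?P k X"
    define r where "r = (\<lambda>x. (1/3) ^ k * sgn (u (m k) x))"
    have meas: "u (m k) \<in> borel_measurable M" using int by auto
    have r: "\<bar>r x\<bar> \<le> (1/3) ^ k" for x
      by (auto simp: r_def abs_mult sgn_if)
    have rP: "r \<in> borel_measurable M" "bounded (range r)"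
      using meas r by (auto simp: r_def bounded_iff)
    have ir: "integrable M (\<lambda>x. u (m k) x * r x)" "integrable M (\<lambda>x. u (m k) x * X x)"
      using integrable_mult_bounded[OF int] rP P by blast+
    have "(LINT x|M. u (m k) x * r x) = (LINT x|M. (1/3) ^ k * \<bar>u (m k) x\<bar>)"
      by (rule Bochner_Integration.integral_cong) (auto simp: r_def abs_sgn mult_ac)
    then have I: "(LINT x|M. u (m k) x * r x) = (1/3) ^ k * (LINT x|M. \<bar>u (m k) x\<bar>)"
      by simp
    have plus: "(LINT x|M. u (m k) x * (X x + r x)) =
        (LINT x|M. u (m k) x * X x) + (LINT x|M. u (m k) x * r x)"
      and minus: "(LINT x|M. u (m k) x * (X x - r x)) =
        (LINT x|M. u (m k) x * X x) - (LINT x|M. u (m k) x * r x)"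
      using ir by (simp_all add: algebra_simps)
    have "(LINT x|M. u (m k) x * r x) \<le> \<bar>LINT x|M. u (m k) x * (X x + r x)\<bar> \<or>
          (LINT x|M. u (m k) x * r x) \<le> \<bar>LINT x|M. u (m k) x * (X x - r x)\<bar>"
      unfolding plus minus by linarith
    then show "\<exists>Y. ?P (Suc k) Y \<and> ?Q k X Y"
    proof
      assume "(LINT x|M. u (m k) x * r x) \<le> \<bar>LINT x|M. u (m k) x * (X x + r x)\<bar>"
      then show ?thesis
        using P rP r I by (intro exI[of _ "\<lambda>x. X x + r x"]) (auto intro: bounded_plus_comp)
    next
      assume "(LINT x|M. u (m k) x * r x) \<le> \<bar>LINT x|M. u (m k) x * (X x - r x)\<bar>"
      then show ?thesis
        using P rP r I by (intro exI[of _ "\<lambda>x. X x - r x"]) (auto intro: bounded_minus_comp)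
    qed
  qed
  then obtain X where X: "\<And>k. X k \<in> borel_measurable M" "\<And>k. bounded (range (X k))"
    and step: "\<And>k x. \<bar>X (Suc k) x - X k x\<bar> \<le> (1/3) ^ k"
    and big: "\<And>k. (1/3) ^ k * (LINT x|M. \<bar>u (m k) x\<bar>) \<le> \<bar>LINT x|M. u (m k) x * X (Suc k) x\<bar>"
    by blast
  \<comment> \<open>The right-hand side is the exact value of the sum of \<open>(1/3) ^ j\<close>
    for \<open>j\<close> from \<open>k\<close> to \<open>k + p - 1\<close>. Keeping the subtracted
    term lets the induction close; it is dropped afterwards.\<close>
  have tail: "\<bar>X (k + p) x - X k x\<bar> \<le> 3/2 * (1/3) ^ k - 3/2 * (1/3) ^ (k + p)" for k p x
  proof (induction p)
    case (Suc p)
    then show ?case using step[of "k + p" x] by simp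
  qed simp
  have tail': "\<bar>X (k + p) x - X k x\<bar> \<le> 3/2 * (1/3) ^ k" for k p x
  proof -
    have "0 \<le> (1/3 :: real) ^ (k + p)" by simp
    then show ?thesis using tail[where k = k and p = p and x = x] by linarith
  qed
  have "convergent (\<lambda>k. X k x)" for x
  proof -
    have "summable (\<lambda>k. X (Suc k) x - X k x)"
      by (rule summable_comparison_test'[where g = "\<lambda>k. (1/3) ^ k"]) (use step in auto)
    then have "convergent (\<lambda>n. \<Sum>k<n. X (Suc k) x - X k x)"
      by (simp add: summable_iff_convergent)
    then have "convergent (\<lambda>n. X n x - X 0 x)"
      by (simp add: sum_lessThan_telescope[of "\<lambda>k. X k x"])
    then show ?thesis
      by (simp add: convergent_diff_const_right_iff)
  qed
  then obtain g where lim: "\<And>x. (\<lambda>k. X k x) \<longlonglongrightarrow> g x"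
    unfolding convergent_def by metis
  have near: "\<bar>g x - X k x\<bar> \<le> 3/2 * (1/3) ^ k" for x k
  proof (rule LIMSEQ_le_const2)
    show "(\<lambda>p. \<bar>X (p + k) x - X k x\<bar>) \<longlonglongrightarrow> \<bar>g x - X k x\<bar>"
      by (intro tendsto_intros LIMSEQ_ignore_initial_segment lim)
    show "\<exists>N. \<forall>n\<ge>N. \<bar>X (n + k) x - X k x\<bar> \<le> 3/2 * (1/3) ^ k"
      using tail'[of k _ x] by (simp add: add.commute)
  qed
  have gm: "g \<in> borel_measurable M"
    using X(1) lim by (rule borel_measurable_LIMSEQ_real[rotated])
  have gb: "bounded (range g)"
  proof -
    obtain B where B: "\<And>x. \<bar>X 0 x\<bar> \<le> B"
      using X(2)[of 0] by (auto simp: bounded_iff)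
    have "\<bar>g x\<bar> \<le> B + 3/2" for x
      using B[of x] near[of x 0] unfolding power_0 by linarith
    then show ?thesis by (auto simp: bounded_iff)
  qed
  obtain K where K: "\<And>n. \<bar>LINT x|M. u n x * g x\<bar> \<le> K"
    using pair[OF gm gb] by (auto simp: Bseq_def)
  \<comment> \<open>The function tuned to \<open>u (m k)\<close> is \<open>X (Suc k)\<close>, so
    \<open>near\<close> is used at \<open>Suc k\<close>, where \<open>3/2 * (1/3) ^ Suc k\<close>
    equals \<open>(1/3) ^ k / 2\<close>. Replacing \<open>X (Suc k)\<close> by \<open>g\<close> thus
    loses at most half of the lower bound in \<open>big\<close>.\<close>
  have "(4/3) ^ k \<le> 2 * K" for k
  proof -
    let ?a = "LINT x|M. \<bar>u (m k) x\<bar>"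
    have ig: "integrable M (\<lambda>x. u (m k) x * g x)" "integrable M (\<lambda>x. u (m k) x * X (Suc k) x)"
      using integrable_mult_bounded[OF int] gm gb X by blast+
    have "\<bar>(LINT x|M. u (m k) x * g x) - (LINT x|M. u (m k) x * X (Suc k) x)\<bar>
        = \<bar>LINT x|M. u (m k) x * g x - u (m k) x * X (Suc k) x\<bar>"
      using ig by simp
    also have "\<dots> \<le> (LINT x|M. \<bar>u (m k) x * g x - u (m k) x * X (Suc k) x\<bar>)"
      by (rule integral_abs_bound)
    also have "\<dots> \<le> (LINT x|M. (1/3) ^ k / 2 * \<bar>u (m k) x\<bar>)"
    proof (rule integral_mono)
      fix x
      have "\<bar>u (m k) x * g x - u (m k) x * X (Suc k) x\<bar> = \<bar>u (m k) x\<bar> * \<bar>g x - X (Suc k) x\<bar>"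
        by (simp add: abs_mult flip: right_diff_distrib)
      also have "\<dots> \<le> \<bar>u (m k) x\<bar> * ((1/3) ^ k / 2)"
        using near[of x "Suc k"] by (intro mult_left_mono) auto
      finally show "\<bar>u (m k) x * g x - u (m k) x * X (Suc k) x\<bar> \<le> (1/3) ^ k / 2 * \<bar>u (m k) x\<bar>"
        by (simp add: mult.commute)
    qed (use ig int in auto)
    also have "\<dots> = (1/3) ^ k * ?a / 2" by simp
    finally have "(1/3) ^ k * ?a / 2 \<le> K"
      using big[of k] K[of "m k"] by linarith
    moreover have "(4/3) ^ k \<le> (1/3) ^ k * ?a"
      using mult_left_mono[OF m[of k], of "(1/3) ^ k"] by (simp flip: power_mult_distrib)
    ultimately show ?thesis by linarith
  qed
  moreover obtain k where "2 * K < (4/3) ^ k"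
    using real_arch_pow[of "4/3" "2 * K"] by auto
  ultimately show False by (meson not_less)
qed

section \<open>Integration over a countable family of elements\<close>

text \<open>Countable additivity: the integral is the limit of finite sums of cell integrals. Cells
  may stick out of the space, so measurability is asked only of their traces on it.\<close>

lemma integral_nonneg_if_nonneg_on_cells:
  fixes f :: "'a \<Rightarrow> real"
  assumes "countable \<T>" and disj: "pairwise disjnt \<T>"
    and meas: "\<And>T. T \<in> \<T> \<Longrightarrow> T \<inter> space M \<in> sets M"
    and cover: "AE x in M. x \<in> \<Union>\<T>"
    and f: "integrable M f"
    and nonneg: "\<And>T. T \<in> \<T> \<Longrightarrow> 0 \<le> (LINT x:T|M. f x)"
  shows "0 \<le> (LINT x|M. f x)"
proof -
  define A where "A = (\<lambda>i. if i \<in> to_nat_on \<T> ` \<T> then from_nat_into \<T> i \<inter> space M else {})"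
  have A: "A i = {} \<or> (\<exists>T\<in>\<T>. i = to_nat_on \<T> T \<and> A i = T \<inter> space M)" for i
    using \<open>countable \<T>\<close> by (auto simp: A_def)
  have UnA: "(\<Union>i. A i) = \<Union>\<T> \<inter> space M"
  proof
    show "(\<Union>i. A i) \<subseteq> \<Union>\<T> \<inter> space M" using A by blast
    have "T \<inter> space M = A (to_nat_on \<T> T)" if "T \<in> \<T>" for T
      using that \<open>countable \<T>\<close> by (auto simp: A_def)
    then show "\<Union>\<T> \<inter> space M \<subseteq> (\<Union>i. A i)" by blast
  qed
  have measA: "A i \<in> sets M" for i using A[of i] meas by auto
  have disjA: "A i \<inter> A j = {}" if "i \<noteq> j" for i j
    using A[of i] A[of j] disj that by (fastforce simp: pairwise_def disjnt_iff)
  have intA: "set_integrable M B f" if "B \<in> sets M" for B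
    using f that unfolding set_integrable_def by (intro integrable_mult_indicator)
  have inter: "(LINT x:T \<inter> space M|M. f x) = (LINT x:T|M. f x)" for T
    unfolding set_lebesgue_integral_def
    by (rule Bochner_Integration.integral_cong) (auto simp: indicator_def)
  have "(LINT x|M. f x) = (LINT x:(\<Union>i. A i)|M. f x)"
    unfolding set_lebesgue_integral_def
  proof (rule integral_cong_AE)
    show "f \<in> borel_measurable M" using f by simp
    show "(\<lambda>x. indicat_real (\<Union>i. A i) x *\<^sub>R f x) \<in> borel_measurable M"
      using f measA by simp
    show "AE x in M. f x = indicat_real (\<Union>i. A i) x *\<^sub>R f x"
      using cover by (auto simp: UnA indicator_def)
  qed
  also have "0 \<le> \<dots>"
  proof (rule LIMSEQ_le_const)
    have "(\<lambda>n. LINT x:(\<Union>i<n. A i)|M. f x) \<longlonglongrightarrow> (LINT x:(\<Union>n. \<Union>i<n. A i)|M. f x)"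
      using measA intA by (intro set_integral_cont_up) (auto simp: incseq_def intro: less_le_trans)
    then show "(\<lambda>n. LINT x:(\<Union>i<n. A i)|M. f x) \<longlonglongrightarrow> (LINT x:(\<Union>i. A i)|M. f x)"
      by (simp only: UN_UN_finite_eq atLeast0LessThan[symmetric])
    have "0 \<le> (LINT x:(\<Union>i<n. A i)|M. f x)" for n
    proof (subst set_integral_finite_Union)
      show "set_integrable M (A i) f" for i
        using f measA unfolding set_integrable_def by (intro integrable_mult_indicator)
      have "0 \<le> (LINT x:(A i)|M. f x)" for i
        using A[of i] nonneg inter by (auto simp: set_lebesgue_integral_def)
      then show "0 \<le> (\<Sum>i<n. LINT x:(A i)|M. f x)" by (simp add: sum_nonneg)
    qed (use disjA measA in \<open>auto simp: disjoint_family_on_def\<close>)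
    then show "\<exists>N. \<forall>n\<ge>N. 0 \<le> (LINT x:(\<Union>i<n. A i)|M. f x)" by blast
  qed
  finally show ?thesis .
qed

section \<open>Square-integrable functions on a bounded set\<close>

lemma integrable_if_L2:
  assumes "bounded \<Omega>" "\<Omega> \<in> sets lebesgue" "u \<in> L2 \<Omega>"
  shows "integrable (lebesgue_on \<Omega>) u"
proof (rule Bochner_Integration.integrable_bound)
  interpret finite_measure "lebesgue_on \<Omega>"
    using bounded_set_imp_lmeasurable[OF assms(1,2)] by (rule finite_measure_lebesgue_on)
  show "integrable (lebesgue_on \<Omega>) (\<lambda>x. 1 + (u x)\<^sup>2)"
    using assms(3) by (auto simp: L2_def)
  show "u \<in> borel_measurable (lebesgue_on \<Omega>)"
    using assms(3) by (simp add: L2_def)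
  \<comment> \<open>The square of \<open>\<bar>t\<bar> - 1/2\<close> is nonnegative; the constant 1
    is integrable because the measure is finite.\<close>
  have "\<bar>t\<bar> \<le> 1 + t\<^sup>2" for t :: real
    using zero_le_power2[of "\<bar>t\<bar> - 1/2"] by (simp add: power2_eq_square algebra_simps)
  then show "AE x in lebesgue_on \<Omega>. norm (u x) \<le> norm (1 + (u x)\<^sup>2)"
    by simp
qed

text \<open>Admits bounded measurable functions as test functions for weak convergence.\<close>

lemma L2_if_bounded:
  assumes "bounded \<Omega>" "\<Omega> \<in> sets lebesgue"
    and "g \<in> borel_measurable (lebesgue_on \<Omega>)" "bounded (range g)"
  shows "g \<in> L2 \<Omega>"
proof -
  interpret finite_measure "lebesgue_on \<Omega>"
    using bounded_set_imp_lmeasurable[OF assms(1,2)] by (rule finite_measure_lebesgue_on)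
  obtain B where "\<And>x. \<bar>g x\<bar> \<le> B"
    using assms(4) by (auto simp: bounded_iff)
  then have "integrable (lebesgue_on \<Omega>) g"
    using assms(3) by (intro integrable_const_bound[of _ B]) auto
  from integrable_mult_bounded[OF this assms(3,4)] show ?thesis
    using assms(3) by (simp add: L2_def power2_eq_square)
qed

section \<open>Pairings with Lipschitz test functions\<close>

lemma borel_measurable_if_lipschitz:
  fixes g :: "'a::euclidean_space \<Rightarrow> real"
  assumes "L-lipschitz_on UNIV g"
  shows "g \<in> borel_measurable (lebesgue_on \<Omega>)"
  using borel_measurable_continuous_onI[OF lipschitz_on_continuous_on[OF assms]]
  by (intro measurable_restrict_space1 measurable_completion) simp

text \<open>On an element containing \<open>p\<close>, the oscillation of \<open>g\<close> is at
  most \<open>L * h\<close>, so the correction \<open>L * h * \<bar>f x\<bar>\<close> makes the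
  integrand dominate \<open>g p * f x\<close>. The latter has nonnegative integral over the element,
  and the elements cover almost all of \<Omega>.\<close>

lemma integral_mult_lipschitz_ge:
  fixes \<Omega> :: "'a::euclidean_space set"
  assumes \<Omega>: "bounded \<Omega>" "\<Omega> \<in> sets lebesgue"
    and part: "partition_into_elements \<Omega> \<T> h"
    and f: "integrable (lebesgue_on \<Omega>) f"
    and means: "\<And>T. T \<in> \<T> \<Longrightarrow> 0 \<le> (LINT x:T|lebesgue_on \<Omega>. f x)"
    and g: "L-lipschitz_on UNIV g" "bounded (range g)" "\<And>x. 0 \<le> g x"
  shows "- (L * h * (LINT x|lebesgue_on \<Omega>. \<bar>f x\<bar>)) \<le> (LINT x|lebesgue_on \<Omega>. f x * g x)"
proof -
  let ?M = "lebesgue_on \<Omega>"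
  let ?F = "\<lambda>x. f x * g x + L * h * \<bar>f x\<bar>"
  have gm: "g \<in> borel_measurable ?M"
    using g(1) by (rule borel_measurable_if_lipschitz)
  have fg: "integrable ?M (\<lambda>x. f x * g x)"
    using f gm g(2) by (rule integrable_mult_bounded)
  have F: "integrable ?M ?F" using f fg by simp
  have openT: "open T" if "T \<in> \<T>" for T
    using part that by (simp add: partition_into_elements_def)
  have TM: "T \<inter> space ?M \<in> sets ?M" if "T \<in> \<T>" for T
    using openT[OF that] \<Omega>(2) by (auto simp: sets_restrict_space)
  have "0 \<le> (LINT x|?M. ?F x)"
  proof (rule integral_nonneg_if_nonneg_on_cells)
    show "pairwise disjnt \<T>" using part by (simp add: partition_into_elements_def)
    with openT show "countable \<T>" by (rule countable_disjoint_open_subsets)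
    have "negligible (\<Omega> - \<Union>\<T>)" using part by (simp add: partition_into_elements_def)
    then have "AE x in lebesgue. x \<notin> \<Omega> - \<Union>\<T>"
      by (intro AE_not_in) (simp add: negligible_iff_null_sets)
    then show "AE x in ?M. x \<in> \<Union>\<T>"
      using \<Omega>(2) by (auto simp: AE_restrict_space_iff elim: eventually_mono)
    fix T assume T: "T \<in> \<T>"
    show "0 \<le> (LINT x:T|?M. ?F x)"
    proof (cases "T = {}")
      case False
      then obtain p where p: "p \<in> T" by blast
      \<comment> \<open>Boundedness of \<open>T\<close> is needed before \<open>diameter T\<close>
        controls distances: as a real supremum, the diameter is meaningful only for bounded
        sets.\<close>
      have "T \<subseteq> closure \<Omega>"
        using part T closure_subset unfolding partition_into_elements_def by blast
      then have "bounded T" using \<Omega>(1) bounded_closure bounded_subset by blast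
      then have osc: "\<bar>g x - g p\<bar> \<le> L * h" if "x \<in> T" for x
      proof -
        have "\<bar>g x - g p\<bar> \<le> L * dist x p"
          using lipschitz_onD[OF g(1), of x p] by (simp add: dist_real_def)
        also have "dist x p \<le> h"
          using diameter_bounded_bound[OF \<open>bounded T\<close> that p] part T
          unfolding partition_into_elements_def by force
        finally show ?thesis
          using lipschitz_on_nonneg[OF g(1)] by (simp add: mult_left_mono)
      qed
      have int: "set_integrable ?M T k" if "integrable ?M k" for k :: "'a \<Rightarrow> real"
      proof -
        have "integrable ?M (\<lambda>x. indicat_real (T \<inter> space ?M) x *\<^sub>R k x)"
          using TM[OF T] that by (rule integrable_mult_indicator)
        then show ?thesis unfolding set_integrable_def
          by (subst Bochner_Integration.integrable_cong[OF refl]) (auto simp: indicator_def)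
      qed
      have "0 \<le> g p * (LINT x:T|?M. f x)"
        using means[OF T] g(3) by simp
      also have "\<dots> = (LINT x:T|?M. g p * f x)" by simp
      also have "\<dots> \<le> (LINT x:T|?M. ?F x)"
      proof (rule set_integral_mono)
        fix x assume "x \<in> T"
        have "- (f x * (g x - g p)) \<le> \<bar>f x\<bar> * \<bar>g x - g p\<bar>"
          by (metis abs_ge_minus_self abs_mult)
        also have "\<dots> \<le> \<bar>f x\<bar> * (L * h)"
          using osc[OF \<open>x \<in> T\<close>] by (simp add: mult_left_mono)
        finally show "g p * f x \<le> ?F x" by (simp add: algebra_simps)
      qed (use f F int in auto)
      finally show ?thesis .
    qed (simp add: set_lebesgue_integral_def)
  qed (use F TM in auto)
  also have "(LINT x|?M. ?F x) = (LINT x|?M. f x * g x) + L * h * (LINT x|?M. \<bar>f x\<bar>)"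
    using f fg by simp
  finally show ?thesis by simp
qed

text \<open>Indicators of closed sets are bounded pointwise limits of Lipschitz functions, so they
  too have nonnegative pairing with \<open>u\<close>. A closed subset of the set where
  \<open>u\<close> is negative must therefore be null, and inner regularity carries this over to the
  whole set.\<close>

lemma AE_nonneg_if_lipschitz_pairings_nonneg:
  fixes u :: "'a::euclidean_space \<Rightarrow> real"
  assumes \<Omega>: "\<Omega> \<in> sets lebesgue" and u: "integrable (lebesgue_on \<Omega>) u"
    and pair: "\<And>L g. L-lipschitz_on UNIV g \<Longrightarrow> bounded (range g) \<Longrightarrow> (\<And>x. 0 \<le> g x) \<Longrightarrow>
       0 \<le> (LINT x|lebesgue_on \<Omega>. u x * g x)"
  shows "AE x in lebesgue_on \<Omega>. 0 \<le> u x"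
proof -
  let ?M = "lebesgue_on \<Omega>"
  have closed_nonneg: "0 \<le> (LINT x|?M. u x * indicator K x)" if K: "closed K" "K \<noteq> {}" for K
  proof (rule LIMSEQ_le_const)
    \<comment> \<open>A cut-off equal to 1 on \<open>K\<close> and, for positive \<open>k\<close>,
      to 0 at distance at least \<open>1 / k\<close> from it. Nonemptiness of \<open>K\<close>
      matters, since \<open>infdist x {}\<close> is 0 and the cut-off would be 1 everywhere.\<close>
    define g where "g = (\<lambda>(k::nat) x. max 0 (1 - real k * infdist x K))"
    have lip: "(real k)-lipschitz_on UNIV (g k)" for k
    proof (rule lipschitz_onI)
      fix x y :: 'a
      have "\<bar>g k x - g k y\<bar> \<le> \<bar>real k * (infdist x K - infdist y K)\<bar>"
        by (simp add: g_def algebra_simps)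
      also have "\<dots> \<le> real k * dist x y"
        using infdist_triangle_abs[of x K y] by (simp add: abs_mult mult_left_mono)
      finally show "dist (g k x) (g k y) \<le> real k * dist x y" by (simp add: dist_real_def)
    qed simp
    have g01: "0 \<le> g k x" "g k x \<le> 1" for k x
      using infdist_nonneg[of x K] by (auto simp: g_def)
    have bdd: "bounded (range (g k))" for k
      using g01 by (auto simp: bounded_iff intro!: exI[of _ 1])
    show "\<exists>N. \<forall>n\<ge>N. 0 \<le> (LINT x|?M. u x * g n x)"
      using pair[OF lip bdd] g01 by blast
    have gm: "g k \<in> borel_measurable ?M" for k
      using lip by (rule borel_measurable_if_lipschitz)
    show "(\<lambda>k. LINT x|?M. u x * g k x) \<longlonglongrightarrow> (LINT x|?M. u x * indicator K x)"
    proof (rule integral_dominated_convergence[where w = "\<lambda>x. \<bar>u x\<bar>"])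
      have "(\<lambda>k. g k x) \<longlonglongrightarrow> indicator K x" for x
      proof (cases "x \<in> K")
        case True
        then show ?thesis by (simp add: g_def)
      next
        case False
        then have pos: "0 < infdist x K" using infdist_pos_not_in_closed K by blast
        then obtain k0 :: nat where k0: "1 < real k0 * infdist x K"
          using reals_Archimedean3 by blast
        have "g k x = 0" if "k \<ge> k0" for k
        proof -
          have "real k0 * infdist x K \<le> real k * infdist x K"
            using that pos by (simp add: mult_right_mono)
          then show ?thesis using k0 by (simp add: g_def)
        qed
        then have "eventually (\<lambda>k. g k x = indicator K x) sequentially"
          using False by (auto simp: eventually_sequentially)
        then show ?thesis by (rule tendsto_eventually)
      qed
      then show "AE x in ?M. (\<lambda>k. u x * g k x) \<longlonglongrightarrow> u x * indicator K x"
        by (auto intro!: tendsto_intros)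
      have "\<bar>u x * g k x\<bar> \<le> \<bar>u x\<bar>" for k x
        using g01[of k x] by (simp add: abs_mult mult_left_le)
      then show "AE x in ?M. norm (u x * g k x) \<le> \<bar>u x\<bar>" for k by simp
      have "indicat_real K \<in> borel_measurable ?M"
        using K(1) by (intro measurable_restrict_space1 measurable_completion) simp
      then show "(\<lambda>x. u x * indicator K x) \<in> borel_measurable ?M"
        using u by simp
    qed (use u gm in auto)
  qed
  define A where "A = {x \<in> \<Omega>. u x < 0}"
  have "{x \<in> space ?M. u x < 0} \<in> sets ?M"
    using borel_measurable_integrable[OF u] by measurable
  then have A: "A \<in> sets lebesgue"
    using \<Omega> by (simp add: A_def space_restrict_space sets_restrict_space_iff)
  \<comment> \<open>The function \<open>- (u x * indicator K x)\<close> is nonnegative with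
    nonpositive integral, hence zero almost everywhere; but it is strictly positive on
    \<open>K\<close>.\<close>
  have null: "K \<in> null_sets lebesgue" if K: "closed K" "K \<subseteq> A" for K
  proof (cases "K = {}")
    case False
    have Km: "K \<in> sets ?M"
      using K \<Omega> by (auto simp: A_def sets_restrict_space_iff)
    have int: "integrable ?M (\<lambda>x. - (u x * indicator K x))"
      using integrable_mult_indicator[OF Km u] by (simp add: mult.commute)
    have sgn: "0 \<le> - (u x * indicator K x)" for x
      using K(2) by (auto simp: A_def indicator_def less_imp_le)
    have "0 \<le> (LINT x|?M. - (u x * indicator K x))"
      using sgn by (intro integral_nonneg_AE) simp
    with closed_nonneg[OF K(1) False] have "(LINT x|?M. - (u x * indicator K x)) = 0"
      by simp
    then have "AE x in ?M. - (u x * indicator K x) = 0"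
      using integral_nonneg_eq_0_iff_AE[OF int] sgn by simp
    then have "AE x in lebesgue. x \<notin> K"
      using \<Omega> K(2) by (auto simp: AE_restrict_space_iff A_def indicator_def elim!: eventually_mono)
    then show ?thesis using K(1) by (simp add: AE_iff_null_sets)
  qed simp
  \<comment> \<open>Removing the null set \<open>K\<close> leaves the measure of \<open>A\<close>
    unchanged, while inner regularity makes the remainder smaller than \<open>e\<close>. The summand
    0 fits the form of \<open>ennreal_le_epsilon\<close>.\<close>
  have "emeasure lebesgue A \<le> 0 + ennreal e" if e: "e > 0" for e
  proof -
    obtain K where K: "closed K" "K \<subseteq> A" "emeasure lebesgue (A - K) < ennreal e"
      by (rule sets_lebesgue_inner_closed[OF A e])
    have "emeasure lebesgue A = emeasure lebesgue (A - K)"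
      using emeasure_Diff_null_set[OF null[OF K(1,2)] A] by simp
    then show ?thesis using K(3) by (simp add: less_imp_le)
  qed
  then have "emeasure lebesgue A \<le> 0"
    by (rule ennreal_le_epsilon)
  then have "A \<in> null_sets lebesgue" using A by (intro null_setsI) simp_all
  then have "AE x in lebesgue. x \<notin> A" by (rule AE_not_in)
  then show ?thesis
    using \<Omega> by (auto simp: AE_restrict_space_iff A_def elim!: eventually_mono)
qed

section \<open>Feasibility of weak limits and optimality\<close>

lemma feasible_weak_limit:
  fixes \<Omega> :: "'a::euclidean_space set"
  assumes \<Omega>: "bounded \<Omega>" "\<Omega> \<in> sets lebesgue"
    and part: "\<And>n. partition_into_elements \<Omega> (\<T> n) (h n)" and h: "h \<longlonglongrightarrow> 0"
    and weak: "weakly_converges \<Omega> us u"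
    and means: "\<And>n T. T \<in> \<T> n \<Longrightarrow> 0 \<le> (LINT x:T|lebesgue_on \<Omega>. us n x)"
  shows "feasible \<Omega> u"
proof -
  let ?M = "lebesgue_on \<Omega>"
  have L2: "us n \<in> L2 \<Omega>" "u \<in> L2 \<Omega>" for n
    using weak by (auto simp: weakly_converges_def)
  have lim: "(\<lambda>n. LINT x|?M. us n x * g x) \<longlonglongrightarrow> (LINT x|?M. u x * g x)"
    if "g \<in> borel_measurable ?M" "bounded (range g)" for g
    using weak L2_if_bounded[OF \<Omega> that] by (simp add: weakly_converges_def)
  have int: "integrable ?M (us n)" for n
    using integrable_if_L2[OF \<Omega> L2(1)] .
  have "Bseq (\<lambda>n. LINT x|?M. \<bar>us n x\<bar>)"
    by (rule Bseq_L1_if_Bseq_pairings[OF int convergent_imp_Bseq[OF convergentI[OF lim]]])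
  then have Bf: "Bfun (\<lambda>n. LINT x|?M. \<bar>us n x\<bar>) sequentially" .
  have "AE x in ?M. 0 \<le> u x"
  proof (rule AE_nonneg_if_lipschitz_pairings_nonneg)
    fix L :: real and g :: "'a \<Rightarrow> real"
    assume g: "L-lipschitz_on UNIV g" "bounded (range g)" "\<And>x. 0 \<le> g x"
    have gm: "g \<in> borel_measurable ?M"
      using g(1) by (rule borel_measurable_if_lipschitz)
    \<comment> \<open>The L1 norms are only bounded, not known to converge, so the error vanishes as
      a null sequence times a bounded one.\<close>
    have "Zfun h sequentially" using h by (simp add: tendsto_Zfun_iff)
    from bounded_bilinear.Zfun_prod_Bfun[OF bounded_bilinear_mult this Bf]
    have "(\<lambda>n. h n * (LINT x|?M. \<bar>us n x\<bar>)) \<longlonglongrightarrow> 0"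
      by (simp add: tendsto_Zfun_iff)
    from tendsto_mult_left[OF this, of "- L"]
    have "(\<lambda>n. - (L * h n * (LINT x|?M. \<bar>us n x\<bar>))) \<longlonglongrightarrow> 0"
      by (simp add: mult.assoc)
    then show "0 \<le> (LINT x|?M. u x * g x)"
      using lim[OF gm g(2)]
      by (rule LIMSEQ_le) (use integral_mult_lipschitz_ge[OF \<Omega> part int means g] in blast)
  qed (use \<Omega> integrable_if_L2[OF \<Omega> L2(2)] in auto)
  with L2 show ?thesis by (simp add: feasible_def)
qed

text \<open>Means are linear, so a nonnegative combination of basis functions inherits the sign of
  their means; the functions themselves may change sign.\<close>

lemma discrete_feasible_mean_nonneg:
  assumes \<Omega>: "bounded \<Omega>" "\<Omega> \<in> sets lebesgue" and T: "T \<in> sets lebesgue"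
    and basis: "L2_basis \<Omega> V N \<phi>" and u: "discrete_feasible \<Omega> V N \<phi> u"
    and means: "\<And>i. i \<in> {1..N} \<Longrightarrow> 0 \<le> (LINT x:T|lebesgue_on \<Omega>. \<phi> i x)"
  shows "0 \<le> (LINT x:T|lebesgue_on \<Omega>. u x)"
proof -
  let ?M = "lebesgue_on \<Omega>"
  obtain c :: "nat \<Rightarrow> real" where c: "\<And>i. i \<in> {1..N} \<Longrightarrow> 0 \<le> c i"
    and eq: "AE x in ?M. u x = (\<Sum>i=1..N. c i * \<phi> i x)"
    using u unfolding discrete_feasible_def ae_eq_def by blast
  have "u \<in> L2 \<Omega>" using u basis by (auto simp: discrete_feasible_def L2_basis_def)
  then have um: "u \<in> borel_measurable ?M" by (simp add: L2_def)
  have \<phi>: "integrable ?M (\<phi> i)" if "i \<in> {1..N}" for i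
    using basis that integrable_if_L2[OF \<Omega>] by (simp add: L2_basis_def)
  have Tm: "indicat_real T \<in> borel_measurable ?M"
    using T by (intro measurable_restrict_space1) simp
  have \<phi>T: "integrable ?M (\<lambda>x. indicat_real T x * \<phi> i x)" if "i \<in> {1..N}" for i
  proof -
    have "bounded (range (indicat_real T))"
      by (auto simp: bounded_iff indicator_def intro!: exI[of _ 1])
    from integrable_mult_bounded[OF \<phi>[OF that] Tm this] show ?thesis
      by (simp add: mult.commute)
  qed
  have "(LINT x:T|?M. u x) = (LINT x|?M. (\<Sum>i=1..N. c i * (indicat_real T x * \<phi> i x)))"
    unfolding set_lebesgue_integral_def
  proof (rule integral_cong_AE)
    show "AE x in ?M. indicat_real T x *\<^sub>R u x = (\<Sum>i=1..N. c i * (indicat_real T x * \<phi> i x))"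
      using eq by eventually_elim (simp add: sum_distrib_left mult_ac)
    show "(\<lambda>x. \<Sum>i=1..N. c i * (indicat_real T x * \<phi> i x)) \<in> borel_measurable ?M"
      using \<phi>T by (intro borel_measurable_sum borel_measurable_integrable integrable_mult_right) auto
  qed (use um Tm in auto)
  also have "\<dots> = (\<Sum>i=1..N. c i * (LINT x:T|?M. \<phi> i x))"
    using \<phi>T by (subst Bochner_Integration.integral_sum) (auto simp: set_lebesgue_integral_def)
  also have "\<dots> \<ge> 0"
    using c means by (intro sum_nonneg mult_nonneg_nonneg) auto
  finally show ?thesis .
qed

theorem theorem3p1:
  fixes \<Omega> :: "(real ^ 'd) set"
    and J :: "(real ^ 'd \<Rightarrow> real) \<Rightarrow> real"
    and ubar :: "real ^ 'd \<Rightarrow> real"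
    and U :: "nat \<Rightarrow> (real ^ 'd \<Rightarrow> real) set"
    and N :: "nat \<Rightarrow> nat"
    and \<phi> :: "nat \<Rightarrow> nat \<Rightarrow> real ^ 'd \<Rightarrow> real"
    and \<T> :: "nat \<Rightarrow> (real ^ 'd) set set"
    and h :: "nat \<Rightarrow> real"
    and Jn :: "nat \<Rightarrow> (real ^ 'd \<Rightarrow> real) \<Rightarrow> real"
  assumes Omega: "bounded \<Omega>" "open \<Omega>"
    and J: "functional_on \<Omega> (L2 \<Omega>) J"
    and ubar: "is_arg_min J (feasible \<Omega>) ubar"
    and A1: "\<And>n. L2_basis \<Omega> (U n) (N n) (\<phi> n)"
    and A2: "\<And>n. partition_into_elements \<Omega> (\<T> n) (h n)" "decseq h" "h \<longlonglongrightarrow> 0"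
    and A3: "\<And>n. functional_on \<Omega> (U n) (Jn n)"
    and Pn_solvable: "\<And>n. \<exists>u. is_arg_min (Jn n) (discrete_feasible \<Omega> (U n) (N n) (\<phi> n)) u"
    and A4: "\<And>us u. (\<And>n. us n \<in> U n) \<Longrightarrow> weakly_converges \<Omega> us u \<Longrightarrow>
               ereal (J u) \<le> liminf (\<lambda>n. ereal (Jn n (us n)))"
    and A5: "\<exists>v. (\<forall>n. discrete_feasible \<Omega> (U n) (N n) (\<phi> n) (v n)) \<and>
               limsup (\<lambda>n. ereal (Jn n (v n))) \<le> ereal (J ubar)"
    and means: "\<And>n T i. T \<in> \<T> n \<Longrightarrow> i \<in> {1..N n} \<Longrightarrow>
               (LINT x:T|lebesgue_on \<Omega>. \<phi> n i x) \<ge> 0"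
  shows "(\<forall>us u. (\<forall>n. discrete_feasible \<Omega> (U n) (N n) (\<phi> n) (us n)) \<longrightarrow>
            weakly_converges \<Omega> us u \<longrightarrow> feasible \<Omega> u) \<and>
         (\<forall>us u. (\<forall>n. is_arg_min (Jn n) (discrete_feasible \<Omega> (U n) (N n) (\<phi> n)) (us n)) \<longrightarrow>
            weakly_converges \<Omega> us u \<longrightarrow> is_arg_min J (feasible \<Omega>) u)"
proof -
  have \<Omega>: "\<Omega> \<in> sets lebesgue" using Omega(2) by simp
  have feas: "feasible \<Omega> u"
    if us: "\<And>n. discrete_feasible \<Omega> (U n) (N n) (\<phi> n) (us n)" and weak: "weakly_converges \<Omega> us u"
    for us u
  proof (rule feasible_weak_limit[OF Omega(1) \<Omega> A2(1) A2(3) weak])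
    fix n T assume T: "T \<in> \<T> n"
    then have "open T" using A2(1)[of n] by (simp add: partition_into_elements_def)
    then show "0 \<le> (LINT x:T|lebesgue_on \<Omega>. us n x)"
      using discrete_feasible_mean_nonneg[OF Omega(1) \<Omega> _ A1 us] means[OF T] by simp
  qed
  moreover have "is_arg_min J (feasible \<Omega>) u"
    if us: "\<And>n. is_arg_min (Jn n) (discrete_feasible \<Omega> (U n) (N n) (\<phi> n)) (us n)"
      and weak: "weakly_converges \<Omega> us u" for us u
  proof -
    have fus: "discrete_feasible \<Omega> (U n) (N n) (\<phi> n) (us n)" for n
      using us by (simp add: is_arg_min_def)
    then have "us n \<in> U n" for n by (simp add: discrete_feasible_def)
    then have "ereal (J u) \<le> liminf (\<lambda>n. ereal (Jn n (us n)))"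
      using weak by (rule A4)
    moreover obtain v where v: "\<And>n. discrete_feasible \<Omega> (U n) (N n) (\<phi> n) (v n)"
      and lsv: "limsup (\<lambda>n. ereal (Jn n (v n))) \<le> ereal (J ubar)"
      using A5 by blast
    \<comment> \<open>The comparison holds for each \<open>n\<close>, because \<open>v n\<close> is
      feasible for the discrete problem that \<open>us n\<close> solves.\<close>
    moreover have "liminf (\<lambda>n. ereal (Jn n (us n))) \<le> liminf (\<lambda>n. ereal (Jn n (v n)))"
      using us v by (intro Liminf_mono) (auto simp: is_arg_min_linorder)
    moreover have "\<dots> \<le> limsup (\<lambda>n. ereal (Jn n (v n)))"
      by (simp add: Liminf_le_Limsup)
    ultimately have "ereal (J u) \<le> ereal (J ubar)" by (meson order_trans)
    \<comment> \<open>The value at \<open>u\<close> does not exceed the minimum, attained at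
      \<open>ubar\<close>, and \<open>u\<close> is feasible by the first claim.\<close>
    then show ?thesis
      using feas[OF fus weak] ubar by (force simp: is_arg_min_linorder)
  qed
  ultimately show ?thesis by blast
qed

end
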